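(* Let $\mathcal H$ and $\mathcal K$ be separable complex Hilbert spaces, $H_0$ a self-adjoint (possibly unbounded) operator in $\mathcal H$, $K\in\mathcal B(\mathcal K,\mathcal H)$, and let $L_1,L_2\in\mathcal B(\mathcal K)$ be self-adjoint. For $\ell=1,2$ define $H_{L_\ell}=H_0+KL_\ell K^*$, $\mathrm{dom}(H_{L_\ell})=\mathrm{dom}(H_0)$, and $M_{L_\ell}(z)=K^*(H_{L_\ell}-z)^{-1}K$, $z\in\mathbb C\setminus\mathbb R$. Then for every $z\in\mathbb C\setminus\mathbb R$, $$M_{L_2}(z)=M_{L_1}(z)\bigl(I_{\mathcal K}+(L_2-L_1)M_{L_1}(z)\bigr)^{-1}=\bigl(I_{\mathcal K}+M_{L_1}(z)(L_2-L_1)\bigr)^{-1}M_{L_1}(z).$$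
   Context: $\mathcal B(\mathcal K,\mathcal H)$ denotes the bounded linear operators from $\mathcal K$ to $\mathcal H$, $\mathcal B(\mathcal K)=\mathcal B(\mathcal K,\mathcal K)$, and $I_{\mathcal K}$ is the identity in $\mathcal K$. The inverses are understood as inverses in $\mathcal B(\mathcal K)$. *)

theory Defs
  imports "HOL-Analysis.Analysis"
begin

section \<open>Complex Hilbert spaces\<close>

class complex_vector = real_vector +
  fixes scaleC :: "complex \<Rightarrow> 'a \<Rightarrow> 'a" (infixr "*\<^sub>C" 75)
  assumes scaleC_add_right: "c *\<^sub>C (x + y) = c *\<^sub>C x + c *\<^sub>C y"
    and scaleC_add_left: "(b + c) *\<^sub>C x = b *\<^sub>C x + c *\<^sub>C x"
    and scaleC_scaleC: "b *\<^sub>C (c *\<^sub>C x) = (b * c) *\<^sub>C x"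
    and scaleC_one: "1 *\<^sub>C x = x"
    and scaleR_scaleC: "r *\<^sub>R x = complex_of_real r *\<^sub>C x"

text \<open>The inner product is linear in the second argument.  It is positive definite
  because its diagonal is the squared norm.\<close>

class complex_inner = complex_vector + real_normed_vector +
  fixes cinner :: "'a \<Rightarrow> 'a \<Rightarrow> complex"
  assumes cinner_commute: "cinner x y = cnj (cinner y x)"
    and cinner_add_right: "cinner x (y + z) = cinner x y + cinner x z"
    and cinner_scaleC_right: "cinner x (c *\<^sub>C y) = c * cinner x y"
    and cinner_norm: "cinner x x = complex_of_real ((norm x)\<^sup>2)"

class chilbert_space = complex_inner + complete_space

instantiation complex :: chilbert_space
begin

definition scaleC_complex :: "complex \<Rightarrow> complex \<Rightarrow> complex"
  where "scaleC_complex c x = c * x"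

definition cinner_complex :: "complex \<Rightarrow> complex \<Rightarrow> complex"
  where "cinner_complex x y = cnj x * y"

instance
proof
  fix x :: complex
  show "cinner x x = complex_of_real ((norm x)\<^sup>2)"
    by (simp only: cinner_complex_def complex_norm_square mult.commute)
qed (simp_all add: scaleC_complex_def cinner_complex_def algebra_simps scaleR_conv_of_real)

end


section \<open>Bounded operators\<close>

text \<open>The type of bounded linear maps in the library is real-linear, so that the space
  B(K,H) consists of those of its elements that are complex-linear.\<close>

definition complex_linear :: "('a::complex_inner \<Rightarrow>\<^sub>L 'b::complex_inner) \<Rightarrow> bool"
  where "complex_linear T \<longleftrightarrow> (\<forall>c x. T (c *\<^sub>C x) = c *\<^sub>C T x)"

definition cadjoint :: "('a::chilbert_space \<Rightarrow>\<^sub>L 'b::chilbert_space) \<Rightarrow> ('b \<Rightarrow>\<^sub>L 'a)"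
  where "cadjoint T = (THE S :: 'b \<Rightarrow>\<^sub>L 'a. \<forall>x y. cinner (T x) y = cinner x (S y))"

definition bounded_self_adjoint :: "('a::chilbert_space \<Rightarrow>\<^sub>L 'a) \<Rightarrow> bool"
  where "bounded_self_adjoint T \<longleftrightarrow> complex_linear T \<and> cadjoint T = T"

definition is_bounded_inverse :: "('a::complex_inner \<Rightarrow>\<^sub>L 'a) \<Rightarrow> ('a \<Rightarrow>\<^sub>L 'a) \<Rightarrow> bool"
  where "is_bounded_inverse T S \<longleftrightarrow>
    complex_linear S \<and> S o\<^sub>L T = id_blinfun \<and> T o\<^sub>L S = id_blinfun"

definition boundedly_invertible :: "('a::complex_inner \<Rightarrow>\<^sub>L 'a) \<Rightarrow> bool"
  where "boundedly_invertible T \<longleftrightarrow> (\<exists>S. is_bounded_inverse T S)"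

definition bounded_inverse :: "('a::complex_inner \<Rightarrow>\<^sub>L 'a) \<Rightarrow> ('a \<Rightarrow>\<^sub>L 'a)"
  where "bounded_inverse T = (THE S. is_bounded_inverse T S)"


section \<open>Unbounded operators\<close>

text \<open>A not necessarily everywhere defined operator is a partial function; its domain
  is \<^term>\<open>dom A\<close>.\<close>

type_synonym 'a partial_op = "'a \<rightharpoonup> 'a"

text \<open>The closure conditions include that the domain is a complex subspace.\<close>

definition linear_op :: "'a::complex_vector partial_op \<Rightarrow> bool"
  where "linear_op A \<longleftrightarrow>
    A 0 = Some 0 \<and>
    (\<forall>x y u v. A x = Some u \<longrightarrow> A y = Some v \<longrightarrow> A (x + y) = Some (u + v)) \<and>
    (\<forall>c x u. A x = Some u \<longrightarrow> A (c *\<^sub>C x) = Some (c *\<^sub>C u))"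

text \<open>A vector \<open>y\<close> is in the domain of the adjoint if some \<open>w\<close> satisfies
  \<open>cinner (A x) y = cinner x w\<close> for all \<open>x\<close> in the domain of \<open>A\<close>, and is then mapped
  to \<open>w\<close>, which is unique for densely defined \<open>A\<close>.\<close>

definition op_adjoint :: "'a::complex_inner partial_op \<Rightarrow> 'a partial_op"
  where "op_adjoint A y =
    (if \<exists>w. \<forall>x\<in>dom A. cinner (the (A x)) y = cinner x w
     then Some (THE w. \<forall>x\<in>dom A. cinner (the (A x)) y = cinner x w)
     else None)"

definition self_adjoint_op :: "'a::chilbert_space partial_op \<Rightarrow> bool"
  where "self_adjoint_op A \<longleftrightarrow>
    linear_op A \<and> closure (dom A) = UNIV \<and> op_adjoint A = A"

definition op_plus_bounded ::
    "'a::complex_inner partial_op \<Rightarrow> ('a \<Rightarrow>\<^sub>L 'a) \<Rightarrow> 'a partial_op"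
  where "op_plus_bounded A B = (\<lambda>x. map_option (\<lambda>u. u + B x) (A x))"

definition op_shift :: "'a::complex_inner partial_op \<Rightarrow> complex \<Rightarrow> 'a partial_op"
  where "op_shift A z = (\<lambda>x. map_option (\<lambda>u. u - z *\<^sub>C x) (A x))"

text \<open>\<open>R\<close> is an everywhere defined bounded inverse of \<open>A - z\<close>: the graph of \<open>R\<close> is the
  converse of the graph of \<open>A - z\<close>.\<close>

definition is_resolvent ::
    "'a::complex_inner partial_op \<Rightarrow> complex \<Rightarrow> ('a \<Rightarrow>\<^sub>L 'a) \<Rightarrow> bool"
  where "is_resolvent A z R \<longleftrightarrow>
    complex_linear R \<and> (\<forall>x y. op_shift A z x = Some y \<longleftrightarrow> R y = x)"

definition resolvent_set :: "'a::complex_inner partial_op \<Rightarrow> complex set"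
  where "resolvent_set A = {z. \<exists>R. is_resolvent A z R}"

definition resolvent :: "'a::complex_inner partial_op \<Rightarrow> complex \<Rightarrow> ('a \<Rightarrow>\<^sub>L 'a)"
  where "resolvent A z = (THE R. is_resolvent A z R)"


section \<open>The perturbed operator and its M-function\<close>

definition H_pert ::
    "'h::chilbert_space partial_op \<Rightarrow> ('k::chilbert_space \<Rightarrow>\<^sub>L 'h) \<Rightarrow> ('k \<Rightarrow>\<^sub>L 'k)
      \<Rightarrow> 'h partial_op"
  where "H_pert H0 K L = op_plus_bounded H0 (K o\<^sub>L L o\<^sub>L cadjoint K)"

definition M_fun ::
    "'h::chilbert_space partial_op \<Rightarrow> ('k::chilbert_space \<Rightarrow>\<^sub>L 'h) \<Rightarrow> ('k \<Rightarrow>\<^sub>L 'k)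
      \<Rightarrow> complex \<Rightarrow> ('k \<Rightarrow>\<^sub>L 'k)"
  where "M_fun H0 K L z = cadjoint K o\<^sub>L resolvent (H_pert H0 K L) z o\<^sub>L K"

end

theory Submission
  imports Defs
begin

text \<open>
  Both perturbed operators are self-adjoint, so every non-real \<open>z\<close> lies in their resolvent
  sets, and the identities come from sandwiching the second resolvent identity.

  Write \<open>\<Delta> = L2 - L1\<close>, \<open>R\<^sub>i\<close> for the resolvents at \<open>z\<close> and \<open>M\<^sub>i = K\<^sup>* R\<^sub>i K\<close>.  The operators
  \<open>H\<^sub>1\<close> and \<open>H\<^sub>2\<close> have the same domain and differ by \<open>K \<Delta> K\<^sup>*\<close>, whence
  \<open>R\<^sub>2 = R\<^sub>1 - R\<^sub>1 K \<Delta> K\<^sup>* R\<^sub>2\<close> (lemma \<open>second_resolvent_identity\<close>).  Multiplying by \<open>K\<^sup>*\<close> on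
  the left and \<open>K\<close> on the right gives \<open>M\<^sub>2 = M\<^sub>1 - M\<^sub>1 \<Delta> M\<^sub>2\<close>, and exchanging the two operators
  gives \<open>M\<^sub>1 = M\<^sub>2 + M\<^sub>2 \<Delta> M\<^sub>1\<close>.  These two equations alone show that \<open>I - \<Delta> M\<^sub>2\<close> is a
  two-sided inverse of \<open>I + \<Delta> M\<^sub>1\<close>, that \<open>I - M\<^sub>2 \<Delta>\<close> is one of \<open>I + M\<^sub>1 \<Delta>\<close>, and that
  \<open>M\<^sub>2 (I + \<Delta> M\<^sub>1) = M\<^sub>1 = (I + M\<^sub>1 \<Delta>) M\<^sub>2\<close>.

  The functional analysis behind this rests on one fact, \<open>exists_orthogonal_to_closed_subspace\<close>:
  a proper closed subspace of a Hilbert space has a non-zero vector orthogonal to it.  Applied to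
  the kernel of a functional it yields the Riesz representation and with it the adjoint \<open>K\<^sup>*\<close>.
  Applied to the range of \<open>A - z\<close> it yields the resolvent of a self-adjoint \<open>A\<close>: the estimate
  \<open>\<bar>Im z\<bar> \<parallel>x\<parallel> \<le> \<parallel>A x - z x\<parallel>\<close> makes \<open>A - z\<close> injective with closed range, and a vector
  orthogonal to the range is an eigenvector of \<open>A\<close> for \<open>cnj z\<close>, which the same estimate excludes.
\<close>

section \<open>Complex inner products\<close>

lemma cinner_add_left: "cinner (x + y) z = cinner x z + cinner y z"
  by (metis cinner_commute cinner_add_right complex_cnj_add)

lemma cinner_scaleC_left: "cinner (c *\<^sub>C x) y = cnj c * cinner x y"
  by (metis cinner_commute cinner_scaleC_right complex_cnj_mult)

lemma cinner_scaleR_right: "cinner x (r *\<^sub>R y) = r *\<^sub>R cinner x y"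
  unfolding scaleR_scaleC[of r y] cinner_scaleC_right scaleR_conv_of_real ..

lemma cinner_scaleR_left: "cinner (r *\<^sub>R x) y = r *\<^sub>R cinner x y"
  unfolding scaleR_scaleC[of r x] cinner_scaleC_left scaleR_conv_of_real by simp

lemma cinner_minus_right: "cinner x (- y) = - cinner x y"
  using cinner_scaleR_right[of x "-1" y] by simp

lemma cinner_minus_left: "cinner (- x) y = - cinner x y"
  using cinner_scaleR_left[of "-1" x y] by simp

lemma cinner_diff_right: "cinner x (y - z) = cinner x y - cinner x z"
  using cinner_add_right[of x y "- z"] by (simp add: cinner_minus_right)

lemma cinner_diff_left: "cinner (x - y) z = cinner x z - cinner y z"
  using cinner_add_left[of x "- y" z] by (simp add: cinner_minus_left)

lemma cinner_zero_right [simp]: "cinner x 0 = 0"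
  using cinner_diff_right[of x 0 0] by simp

lemma cinner_zero_left [simp]: "cinner 0 x = 0"
  using cinner_diff_left[of 0 0 x] by simp

lemmas cinner_simps = cinner_add_left cinner_add_right cinner_diff_left cinner_diff_right
  cinner_scaleC_left cinner_scaleC_right

lemma cinner_self_eq_0_iff: "cinner x x = 0 \<longleftrightarrow> x = 0"
  by (simp add: cinner_norm)

lemma norm_scaleC: "norm (c *\<^sub>C (x::'a::complex_inner)) = cmod c * norm x"
proof -
  have "complex_of_real ((norm (c *\<^sub>C x))\<^sup>2) = (c * cnj c) * complex_of_real ((norm x)\<^sup>2)"
    by (simp only: cinner_norm[symmetric] cinner_simps ac_simps)
  also have "\<dots> = complex_of_real ((cmod c * norm x)\<^sup>2)"
    by (simp only: complex_norm_square[symmetric] of_real_mult power_mult_distrib)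
  finally have "(norm (c *\<^sub>C x))\<^sup>2 = (cmod c * norm x)\<^sup>2"
    using of_real_eq_iff by blast
  then show ?thesis
    by (simp add: power2_eq_iff_nonneg)
qed

lemma scaleC_diff_right: "c *\<^sub>C (x - y) = c *\<^sub>C x - c *\<^sub>C (y::'a::complex_vector)"
  using scaleC_add_right[of c "x - y" y] by (simp add: algebra_simps)

lemma scaleC_scaleR: "c *\<^sub>C (r *\<^sub>R x) = r *\<^sub>R (c *\<^sub>C (x::'a::complex_vector))"
  by (simp add: scaleR_scaleC scaleC_scaleC mult.commute)

lemma scaleC_zero_right [simp]: "c *\<^sub>C (0::'a::complex_vector) = 0"
  using scaleC_diff_right[of c 0 0] by simp

lemma minus_eq_scaleC: "- x = (-1) *\<^sub>C (x::'a::complex_vector)"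
  using scaleR_scaleC[of "-1" x] by simp

lemma bounded_linear_scaleC:
  "bounded_linear (\<lambda>x::'a::complex_inner. c *\<^sub>C x)"
  by (rule bounded_linear_intro[of _ "cmod c"])
    (simp_all add: scaleC_add_right scaleC_scaleR norm_scaleC mult.commute)

lemma norm_diff_square:
  "(norm (x - y))\<^sup>2 = (norm x)\<^sup>2 - 2 * Re (cinner x y) + (norm (y::'a::complex_inner))\<^sup>2"
proof -
  have "complex_of_real ((norm (x - y))\<^sup>2)
      = of_real ((norm x)\<^sup>2) - (cinner x y + cnj (cinner x y)) + of_real ((norm y)\<^sup>2)"
    unfolding cinner_norm[symmetric] cinner_commute[of y x, symmetric]
    by (simp only: cinner_simps) algebra
  also have "cinner x y + cnj (cinner x y) = of_real (2 * Re (cinner x y))"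
    by (rule complex_add_cnj)
  finally show ?thesis
    unfolding of_real_diff[symmetric] of_real_add[symmetric] of_real_eq_iff .
qed

text \<open>The vector subtracted is the orthogonal projection of \<open>y\<close> to the line through \<open>s\<close>.  That
  the right-hand side is non-negative is the Cauchy-Schwarz inequality; that it is less than
  \<open>(norm y)\<^sup>2\<close> unless \<open>cinner s y = 0\<close> is how orthogonality follows from minimality of a norm.\<close>

lemma norm_square_minus_projection:
  fixes s y :: "'a::complex_inner"
  assumes "s \<noteq> 0"
  shows "(norm (y - (cinner s y / of_real ((norm s)\<^sup>2)) *\<^sub>C s))\<^sup>2
    = (norm y)\<^sup>2 - (cmod (cinner s y))\<^sup>2 / (norm s)\<^sup>2"
proof -
  let ?c = "cinner s y / of_real ((norm s)\<^sup>2)"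
  have "cinner y (?c *\<^sub>C s) = cinner s y * cnj (cinner s y) / of_real ((norm s)\<^sup>2)"
    by (simp add: cinner_scaleC_right cinner_commute[of y s])
  also have "\<dots> = of_real ((cmod (cinner s y))\<^sup>2 / (norm s)\<^sup>2)"
    by (simp only: complex_norm_square[symmetric] of_real_divide)
  finally have "Re (cinner y (?c *\<^sub>C s)) = (cmod (cinner s y))\<^sup>2 / (norm s)\<^sup>2"
    by (simp only: Re_complex_of_real)
  moreover have "(norm (?c *\<^sub>C s))\<^sup>2 = (cmod (cinner s y))\<^sup>2 / (norm s)\<^sup>2"
    using assms by (simp add: norm_scaleC norm_divide power2_eq_square norm_mult)
  ultimately show ?thesis
    by (simp add: norm_diff_square)
qed

lemma Cauchy_Schwarz_cinner:
  fixes x y :: "'a::complex_inner"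
  shows "cmod (cinner x y) \<le> norm x * norm y"
proof (cases "x = 0")
  case False
  then have "(cmod (cinner x y))\<^sup>2 / (norm x)\<^sup>2 \<le> (norm y)\<^sup>2"
    using norm_square_minus_projection[OF False, of y] zero_le_power2 by (metis diff_ge_0_iff_ge)
  then have "(cmod (cinner x y))\<^sup>2 \<le> (norm x * norm y)\<^sup>2"
    using False by (simp add: power_mult_distrib field_simps)
  then show ?thesis
    by (rule power2_le_imp_le) simp
qed simp

lemma bounded_bilinear_cinner:
  "bounded_bilinear (cinner :: 'a::complex_inner \<Rightarrow> 'a \<Rightarrow> complex)"
proof
  show "\<exists>k. \<forall>(a::'a) b. norm (cinner a b) \<le> norm a * norm b * k"
    using Cauchy_Schwarz_cinner[where ?'a = 'a] by (intro exI[of _ 1]) simp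
qed (simp_all add: cinner_simps cinner_scaleR_left cinner_scaleR_right)

lemmas tendsto_cinner = bounded_bilinear.tendsto[OF bounded_bilinear_cinner]

lemma cinner_ext_right:
  assumes "\<And>x. cinner x y = cinner x y'"
  shows "y = (y'::'a::complex_inner)"
  using assms[of "y - y'"] cinner_self_eq_0_iff[of "y - y'"] by (simp add: cinner_diff_right)

lemma orthogonal_to_dense_set_eq_0:
  fixes y :: "'a::complex_inner"
  assumes "closure S = UNIV" and "\<And>x. x \<in> S \<Longrightarrow> cinner x y = 0"
  shows "y = 0"
proof -
  obtain f where f: "\<And>n. f n \<in> S" "f \<longlonglongrightarrow> y"
    using assms(1) closure_sequential[of y S] by auto
  have "(\<lambda>n. cinner (f n) y) \<longlonglongrightarrow> cinner y y"
    by (intro tendsto_cinner f(2) tendsto_const)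
  then have "cinner y y = 0"
    using assms(2)[OF f(1)] by (simp add: LIMSEQ_const_iff)
  then show ?thesis
    by (simp add: cinner_self_eq_0_iff)
qed


section \<open>Orthogonal complements, Riesz representation and adjoints\<close>

lemma parallelogram_law:
  fixes x y :: "'a::complex_inner"
  shows "(norm (x - y))\<^sup>2 = 2 * (norm x)\<^sup>2 + 2 * (norm y)\<^sup>2 - (norm (x + y))\<^sup>2"
  using norm_diff_square[of x y] norm_diff_square[of x "- y"] by (simp add: cinner_minus_right)

text \<open>A sequence in \<open>S\<close> whose distance to \<open>x\<close> tends to the infimum is Cauchy: midpoints stay in
  \<open>S\<close>, hence at distance at least the infimum from \<open>x\<close>, and the parallelogram law then bounds the
  distance of two members.  The limit is a point of \<open>S\<close> nearest to \<open>x\<close>.\<close>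

lemma exists_nearest_point:
  fixes S :: "'a::chilbert_space set"
  assumes "closed S" and "S \<noteq> {}"
    and midpoint: "\<And>a b. a \<in> S \<Longrightarrow> b \<in> S \<Longrightarrow> (1/2) *\<^sub>R (a + b) \<in> S"
  shows "\<exists>p\<in>S. \<forall>s\<in>S. norm (x - p) \<le> norm (x - s)"
proof -
  define d where "d = infdist x S"
  have d_le: "d \<le> norm (x - s)" if "s \<in> S" for s
    using infdist_le[OF that, of x] by (simp add: d_def dist_norm)
  have d_nonneg: "0 \<le> d"
    by (simp add: d_def infdist_nonneg)
  have "\<exists>s\<in>S. norm (x - s) < d + inverse (real (Suc n))" for n
  proof -
    have "(INF a\<in>S. dist x a) < d + inverse (real (Suc n))"
      using assms(2) by (simp add: d_def infdist_def)
    then show ?thesis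
      using assms(2) by (subst (asm) cINF_less_iff) (auto simp: dist_norm intro: bdd_belowI2[of _ 0])
  qed
  then obtain f where f: "\<And>n. f n \<in> S" "\<And>n. norm (x - f n) < d + inverse (real (Suc n))"
    by metis
  have lim: "(\<lambda>n. d + inverse (real (Suc n))) \<longlonglongrightarrow> d"
    using tendsto_add[OF tendsto_const LIMSEQ_inverse_real_of_nat, of d] by simp
  have dist_sq: "(dist (f m) (f n))\<^sup>2 \<le> 4 * ((d + inverse (real (Suc N)))\<^sup>2 - d\<^sup>2)"
    if "N \<le> m" "N \<le> n" for m n N
  proof -
    have bound: "(norm (x - f k))\<^sup>2 \<le> (d + inverse (real (Suc N)))\<^sup>2" if "N \<le> k" for k
    proof -
      have "inverse (real (Suc k)) \<le> inverse (real (Suc N))"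
        using that by (intro le_imp_inverse_le) auto
      then have "norm (x - f k) \<le> d + inverse (real (Suc N))"
        using f(2)[of k] by linarith
      then show ?thesis
        by (rule power_mono) simp
    qed
    have "(x - f m) + (x - f n) = 2 *\<^sub>R (x - (1/2) *\<^sub>R (f m + f n))"
      by (simp add: algebra_simps scaleR_2)
    then have "norm ((x - f m) + (x - f n)) = 2 * norm (x - (1/2) *\<^sub>R (f m + f n))"
      by simp
    moreover have "d\<^sup>2 \<le> (norm (x - (1/2) *\<^sub>R (f m + f n)))\<^sup>2"
      using d_le[OF midpoint[OF f(1) f(1)]] d_nonneg by (intro power_mono)
    ultimately have "4 * d\<^sup>2 \<le> (norm ((x - f m) + (x - f n)))\<^sup>2"
      by (simp add: power_mult_distrib)
    moreover have "dist (f m) (f n) = norm ((x - f m) - (x - f n))"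
      by (simp add: dist_norm norm_minus_commute)
    ultimately show ?thesis
      using bound[OF that(1)] bound[OF that(2)] parallelogram_law[of "x - f m" "x - f n"]
      by (simp add: right_diff_distrib)
  qed
  have "Cauchy f"
  proof (rule metric_CauchyI)
    fix e :: real
    assume "0 < e"
    have "(\<lambda>n. 4 * ((d + inverse (real (Suc n)))\<^sup>2 - d\<^sup>2)) \<longlonglongrightarrow> 4 * (d\<^sup>2 - d\<^sup>2)"
      by (intro tendsto_intros lim)
    then have "(\<lambda>n. 4 * ((d + inverse (real (Suc n)))\<^sup>2 - d\<^sup>2)) \<longlonglongrightarrow> 0"
      by simp
    then have "\<forall>\<^sub>F N in sequentially. 4 * ((d + inverse (real (Suc N)))\<^sup>2 - d\<^sup>2) < e\<^sup>2"
      using \<open>0 < e\<close> by (intro order_tendstoD(2)) auto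
    then obtain N where N: "4 * ((d + inverse (real (Suc N)))\<^sup>2 - d\<^sup>2) < e\<^sup>2"
      by (auto simp: eventually_sequentially)
    have "dist (f m) (f n) < e" if "N \<le> m" "N \<le> n" for m n
      using dist_sq[OF that] N \<open>0 < e\<close> by (intro power2_less_imp_less[of _ e]) auto
    then show "\<exists>M. \<forall>m\<ge>M. \<forall>n\<ge>M. dist (f m) (f n) < e"
      by blast
  qed
  then obtain p where p: "f \<longlonglongrightarrow> p"
    using Cauchy_convergent convergent_def by blast
  have "p \<in> S"
    using assms(1) f(1) p closed_sequentially by blast
  have "(\<lambda>n. norm (x - f n)) \<longlonglongrightarrow> norm (x - p)"
    by (intro tendsto_intros p)
  then have "norm (x - p) \<le> d"
    using lim by (rule LIMSEQ_le) (use f(2) less_imp_le in blast)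
  then show ?thesis
    using \<open>p \<in> S\<close> d_le order_trans by blast
qed

text \<open>If \<open>p\<close> is the point of \<open>S\<close> nearest to \<open>x\<close>, then \<open>y = x - p\<close> is orthogonal to \<open>S\<close>, since
  otherwise subtracting from \<open>y\<close> its projection to some \<open>s \<in> S\<close> would give a vector shorter than
  \<open>y\<close> that still leads from a point of \<open>S\<close> to \<open>x\<close>.\<close>

lemma exists_orthogonal_to_closed_subspace:
  fixes S :: "'a::chilbert_space set"
  assumes "closed S" and "0 \<in> S"
    and add: "\<And>a b. a \<in> S \<Longrightarrow> b \<in> S \<Longrightarrow> a + b \<in> S"
    and scale: "\<And>c a. a \<in> S \<Longrightarrow> c *\<^sub>C a \<in> S"
    and "x \<notin> S"
  shows "\<exists>y. y \<noteq> 0 \<and> (\<forall>s\<in>S. cinner s y = 0)"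
proof -
  have "\<exists>p\<in>S. \<forall>s\<in>S. norm (x - p) \<le> norm (x - s)"
    using assms(1,2) add scale by (intro exists_nearest_point) (auto simp: scaleR_scaleC)
  then obtain p where p: "p \<in> S" "\<And>s. s \<in> S \<Longrightarrow> norm (x - p) \<le> norm (x - s)"
    by blast
  have "cinner s (x - p) = 0" if "s \<in> S" for s
  proof (cases "s = 0")
    case False
    let ?y = "x - p"
    let ?t = "(cinner s ?y / of_real ((norm s)\<^sup>2)) *\<^sub>C s"
    have "norm ?y \<le> norm (?y - ?t)"
      using p(2)[OF add[OF p(1) scale[OF that]]] by (simp add: diff_diff_eq)
    then have "(norm ?y)\<^sup>2 \<le> (norm (?y - ?t))\<^sup>2"
      by (rule power_mono) simp
    then have "(cmod (cinner s ?y))\<^sup>2 / (norm s)\<^sup>2 \<le> 0"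
      unfolding norm_square_minus_projection[OF False] by simp
    then show ?thesis
      using False by (simp add: divide_le_0_iff)
  qed simp
  moreover have "x - p \<noteq> 0"
    using p(1) assms(5) by auto
  ultimately show ?thesis
    by blast
qed

text \<open>The kernel of a non-zero functional has codimension one, so that a vector orthogonal to it
  represents the functional up to a scalar.\<close>

lemma Riesz_representation:
  fixes f :: "'a::chilbert_space \<Rightarrow> complex"
  assumes "bounded_linear f" and scale: "\<And>c x. f (c *\<^sub>C x) = c * f x"
  shows "\<exists>w. \<forall>x. f x = cinner w x"
proof (cases "\<forall>x. f x = 0")
  case True
  then show ?thesis
    by (intro exI[of _ 0]) simp
next
  case False
  interpret f: bounded_linear f by fact
  obtain x0 where "f x0 \<noteq> 0"
    using False by blast
  let ?S = "{x. f x = 0}"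
  have "closed ?S"
    by (intro closed_Collect_eq continuous_on_const f.continuous_on continuous_on_id)
  then have "\<exists>y. y \<noteq> 0 \<and> (\<forall>s\<in>?S. cinner s y = 0)"
    by (rule exists_orthogonal_to_closed_subspace[where x = x0])
      (simp_all add: f.add scale \<open>f x0 \<noteq> 0\<close> f.zero)
  then obtain y where y: "y \<noteq> 0" "\<And>s. f s = 0 \<Longrightarrow> cinner s y = 0"
    by blast
  then have fy: "f y \<noteq> 0"
    using cinner_self_eq_0_iff by blast
  have "f x = cinner ((cnj (f y) / of_real ((norm y)\<^sup>2)) *\<^sub>C y) x" for x
  proof -
    have "f (x - (f x / f y) *\<^sub>C y) = 0"
      using fy by (simp add: f.diff scale)
    then have "cinner y (x - (f x / f y) *\<^sub>C y) = 0"
      using y(2) cinner_commute[of y "x - (f x / f y) *\<^sub>C y"] by simp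
    then have "cinner y x = f x / f y * of_real ((norm y)\<^sup>2)"
      by (simp add: cinner_simps cinner_norm)
    then show ?thesis
      using fy y(1) by (simp add: cinner_scaleC_left)
  qed
  then show ?thesis
    by blast
qed

lemma exists_adjoint:
  fixes T :: "'a::chilbert_space \<Rightarrow>\<^sub>L 'b::chilbert_space"
  assumes "complex_linear T"
  shows "\<exists>S::'b \<Rightarrow>\<^sub>L 'a. \<forall>x y. cinner (T x) y = cinner x (S y)"
proof -
  have "\<exists>w. \<forall>x. cinner y (T x) = cinner w x" for y
  proof (rule Riesz_representation)
    show "bounded_linear (\<lambda>x. cinner y (T x))"
      by (intro bounded_linear_compose[OF bounded_bilinear.bounded_linear_right
            [OF bounded_bilinear_cinner]] blinfun.bounded_linear_right)
  qed (use assms in \<open>simp add: complex_linear_def cinner_scaleC_right\<close>)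
  then obtain S where "\<And>y x. cinner y (T x) = cinner (S y) x"
    by metis
  then have S: "cinner (T x) y = cinner x (S y)" for x y
    using cinner_commute[of "T x" y] cinner_commute[of x "S y"] by simp
  have "bounded_linear S"
  proof (rule bounded_linear_intro)
    fix y y' :: 'b and r :: real
    show "S (y + y') = S y + S y'"
      by (rule cinner_ext_right) (simp add: cinner_add_right S[symmetric])
    show "S (r *\<^sub>R y) = r *\<^sub>R S y"
      by (rule cinner_ext_right) (simp add: cinner_scaleR_right S[symmetric])
    have "(norm (S y))\<^sup>2 = cmod (cinner (T (S y)) y)"
      by (simp add: S cinner_norm norm_power)
    also have "\<dots> \<le> norm (T (S y)) * norm y"
      by (rule Cauchy_Schwarz_cinner)
    also have "\<dots> \<le> (norm T * norm (S y)) * norm y"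
      by (intro mult_right_mono norm_blinfun) simp
    finally have "norm (S y) * norm (S y) \<le> norm (S y) * (norm y * norm T)"
      by (simp add: power2_eq_square ac_simps)
    then show "norm (S y) \<le> norm y * norm T"
      by (cases "S y = 0") (auto simp: mult_le_cancel_left)
  qed
  then show ?thesis
    using S by (intro exI[of _ "Blinfun S"]) (simp add: bounded_linear_Blinfun_apply)
qed

lemma cinner_cadjoint:
  fixes T :: "'a::chilbert_space \<Rightarrow>\<^sub>L 'b::chilbert_space"
  assumes "complex_linear T"
  shows "cinner (T x) y = cinner x (cadjoint T y)"
proof -
  have "\<exists>!S::'b \<Rightarrow>\<^sub>L 'a. \<forall>x y. cinner (T x) y = cinner x (S y)"
  proof (rule ex_ex1I[OF exists_adjoint[OF assms]])
    fix S S' :: "'b \<Rightarrow>\<^sub>L 'a"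
    assume *: "\<forall>x y. cinner (T x) y = cinner x (S y)" "\<forall>x y. cinner (T x) y = cinner x (S' y)"
    show "S = S'"
    proof (rule blinfun_eqI, rule cinner_ext_right)
      show "cinner x (S y) = cinner x (S' y)" for x y
        using * by simp
    qed
  qed
  from theI'[OF this] show ?thesis
    unfolding cadjoint_def by blast
qed

lemma complex_linear_cadjoint:
  fixes T :: "'a::chilbert_space \<Rightarrow>\<^sub>L 'b::chilbert_space"
  assumes "complex_linear T"
  shows "complex_linear (cadjoint T)"
  unfolding complex_linear_def
proof (intro allI)
  fix c y
  show "cadjoint T (c *\<^sub>C y) = c *\<^sub>C cadjoint T y"
  proof (rule cinner_ext_right)
    fix x
    show "cinner x (cadjoint T (c *\<^sub>C y)) = cinner x (c *\<^sub>C cadjoint T y)"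
      by (simp only: cinner_scaleC_right cinner_cadjoint[OF assms, symmetric])
  qed
qed


section \<open>Self-adjoint operators\<close>

text \<open>Density of the domain makes the vector \<open>w\<close> unique, so that the adjoint is described by its
  graph, without choice.\<close>

lemma op_adjoint_eq_Some_iff:
  assumes "closure (dom A) = UNIV"
  shows "op_adjoint A y = Some w \<longleftrightarrow> (\<forall>x u. A x = Some u \<longrightarrow> cinner u y = cinner x w)"
proof -
  let ?P = "\<lambda>w. \<forall>x\<in>dom A. cinner (the (A x)) y = cinner x w"
  have unique: "w' = w''" if "?P w'" "?P w''" for w' w''
  proof -
    have "cinner x (w' - w'') = 0" if "x \<in> dom A" for x
      using that \<open>?P w'\<close> \<open>?P w''\<close> by (metis cinner_diff_right right_minus_eq)
    then show ?thesis
      using orthogonal_to_dense_set_eq_0[OF assms] by (metis right_minus_eq)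
  qed
  have "op_adjoint A y = Some w \<longleftrightarrow> ?P w"
  proof (cases "\<exists>w. ?P w")
    case True
    then have "\<exists>!w. ?P w"
      using unique by blast
    then have P: "?P (THE w. ?P w)"
      by (rule theI')
    have "op_adjoint A y = Some (THE w. ?P w)"
      unfolding op_adjoint_def by (rule if_P[OF True])
    moreover have "(THE w. ?P w) = w \<longleftrightarrow> ?P w"
      using unique[OF P] P by blast
    ultimately show ?thesis
      by simp
  next
    case False
    have "op_adjoint A y = None"
      unfolding op_adjoint_def by (rule if_not_P[OF False])
    then show ?thesis
      using False by simp
  qed
  also have "\<dots> \<longleftrightarrow> (\<forall>x u. A x = Some u \<longrightarrow> cinner u y = cinner x w)"
    by force
  finally show ?thesis .
qed

lemma self_adjoint_op_graph:
  assumes "self_adjoint_op A"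
  shows "A y = Some w \<longleftrightarrow> (\<forall>x u. A x = Some u \<longrightarrow> cinner u y = cinner x w)"
  using assms op_adjoint_eq_Some_iff[of A y w] by (simp add: self_adjoint_op_def)

text \<open>A bounded symmetric summand moves to the other side of the inner product, so that \<open>w\<close> is
  the value of the adjoint of \<open>A + B\<close> at \<open>y\<close> iff \<open>w - B y\<close> is that of the adjoint of \<open>A\<close>.\<close>

lemma self_adjoint_op_plus_bounded:
  assumes A: "self_adjoint_op A" and "complex_linear B"
    and symmetric: "\<And>x y. cinner (B x) y = cinner x (B y)"
  shows "self_adjoint_op (op_plus_bounded A B)"
proof -
  let ?C = "op_plus_bounded A B"
  have C: "?C x = Some v \<longleftrightarrow> A x = Some (v - B x)" for x v
    by (auto simp: op_plus_bounded_def)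
  have lin: "linear_op A"
    using A by (simp add: self_adjoint_op_def)
  have "dom ?C = dom A"
    by (auto simp: op_plus_bounded_def dom_def)
  then have dense: "closure (dom ?C) = UNIV"
    using A by (simp add: self_adjoint_op_def)
  have "linear_op ?C"
    using lin assms(2)
    by (auto simp: linear_op_def C complex_linear_def blinfun.add_right blinfun.zero_right
        scaleC_diff_right add_diff_add)
  moreover have "op_adjoint ?C = ?C"
  proof
    fix y
    have "op_adjoint ?C y = Some w \<longleftrightarrow> ?C y = Some w" for w
    proof -
      have "op_adjoint ?C y = Some w
          \<longleftrightarrow> (\<forall>x u. A x = Some u \<longrightarrow> cinner (u + B x) y = cinner x w)"
        unfolding op_adjoint_eq_Some_iff[OF dense]
        by (auto simp: op_plus_bounded_def)
      also have "\<dots> \<longleftrightarrow> (\<forall>x u. A x = Some u \<longrightarrow> cinner u y = cinner x (w - B y))"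
        by (simp add: cinner_simps symmetric eq_diff_eq)
      also have "\<dots> \<longleftrightarrow> ?C y = Some w"
        by (simp only: C self_adjoint_op_graph[OF A, symmetric])
      finally show ?thesis .
    qed
    then show "op_adjoint ?C y = ?C y"
      by (metis option.exhaust)
  qed
  ultimately show ?thesis
    using dense unfolding self_adjoint_op_def by blast
qed

text \<open>The quadratic form \<open>cinner x (A x)\<close> is real, hence \<open>cinner x (A x - z x)\<close> has imaginary
  part \<open>- Im z * (norm x)\<^sup>2\<close>, and Cauchy-Schwarz applies.\<close>

lemma self_adjoint_op_lower_bound:
  assumes "self_adjoint_op A" and "A x = Some u"
  shows "\<bar>Im z\<bar> * norm x \<le> norm (u - z *\<^sub>C x)"
proof (cases "x = 0")
  case False
  have "cinner u x = cinner x u"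
    using assms self_adjoint_op_graph by blast
  then have "Im (cinner x u) = 0"
    using cinner_commute[of u x] by (metis Im_complex_of_real Reals_cases Reals_cnj_iff)
  then have "Im (cinner x (u - z *\<^sub>C x)) = - (Im z * (norm x)\<^sup>2)"
    by (simp add: cinner_simps cinner_norm flip: of_real_power)
  then have "\<bar>Im z\<bar> * (norm x)\<^sup>2 \<le> cmod (cinner x (u - z *\<^sub>C x))"
    using abs_Im_le_cmod[of "cinner x (u - z *\<^sub>C x)"] by (simp add: abs_mult)
  also have "\<dots> \<le> norm x * norm (u - z *\<^sub>C x)"
    by (rule Cauchy_Schwarz_cinner)
  finally have "norm x * (\<bar>Im z\<bar> * norm x) \<le> norm x * norm (u - z *\<^sub>C x)"
    by (simp add: power2_eq_square ac_simps)
  then show ?thesis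
    using False by simp
qed simp

text \<open>The lower bound turns convergence of \<open>A x\<^sub>n - z x\<^sub>n\<close> into convergence of \<open>x\<^sub>n\<close>, and the graph
  of \<open>A\<close>, being that of an adjoint, is closed.\<close>

lemma self_adjoint_op_closed_range:
  fixes A :: "'a::chilbert_space partial_op"
  assumes A: "self_adjoint_op A" and z: "Im z \<noteq> 0"
  shows "closed {u - z *\<^sub>C x | x u. A x = Some u}"
  unfolding closed_sequential_limits
proof (intro allI impI, elim conjE)
  fix f v
  assume range: "\<forall>n. f n \<in> {u - z *\<^sub>C x | x u. A x = Some u}" and v: "f \<longlonglongrightarrow> v"
  have "\<forall>n. \<exists>x u. A x = Some u \<and> f n = u - z *\<^sub>C x"
    using range by blast
  then obtain x u where xu: "\<And>n. A (x n) = Some (u n)" "\<And>n. f n = u n - z *\<^sub>C x n"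
    by metis
  have lin: "linear_op A"
    using A by (simp add: self_adjoint_op_def)
  have bound: "\<bar>Im z\<bar> * norm (x m - x n) \<le> norm (f m - f n)" for m n
  proof -
    have "A (x m + (-1) *\<^sub>C x n) = Some (u m + (-1) *\<^sub>C u n)"
      using lin xu(1) by (simp add: linear_op_def)
    then have "A (x m - x n) = Some (u m - u n)"
      by (simp add: minus_eq_scaleC[symmetric])
    from self_adjoint_op_lower_bound[OF A this, of z] show ?thesis
      by (simp add: xu(2) scaleC_diff_right algebra_simps)
  qed
  have "Cauchy x"
  proof (rule metric_CauchyI)
    fix e :: real
    assume "0 < e"
    then have "0 < \<bar>Im z\<bar> * e"
      using z by simp
    then obtain M where M: "\<And>m n. M \<le> m \<Longrightarrow> M \<le> n \<Longrightarrow> dist (f m) (f n) < \<bar>Im z\<bar> * e"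
      using metric_CauchyD[OF LIMSEQ_imp_Cauchy[OF v]] by blast
    have "dist (x m) (x n) < e" if "M \<le> m" "M \<le> n" for m n
    proof -
      have "\<bar>Im z\<bar> * norm (x m - x n) < \<bar>Im z\<bar> * e"
        using bound[of m n] M[OF that] by (simp add: dist_norm)
      then show ?thesis
        using z by (simp add: dist_norm)
    qed
    then show "\<exists>M. \<forall>m\<ge>M. \<forall>n\<ge>M. dist (x m) (x n) < e"
      by blast
  qed
  then obtain x' where x': "x \<longlonglongrightarrow> x'"
    using Cauchy_convergent convergent_def by blast
  have "(\<lambda>n. f n + z *\<^sub>C x n) \<longlonglongrightarrow> v + z *\<^sub>C x'"
    by (intro tendsto_add v bounded_linear.tendsto[OF bounded_linear_scaleC] x')
  then have u: "u \<longlonglongrightarrow> v + z *\<^sub>C x'"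
    by (simp add: xu(2))
  have "cinner b x' = cinner a (v + z *\<^sub>C x')" if "A a = Some b" for a b
  proof (rule LIMSEQ_unique)
    show "(\<lambda>n. cinner b (x n)) \<longlonglongrightarrow> cinner b x'"
      by (intro tendsto_cinner tendsto_const x')
    have "cinner b (x n) = cinner a (u n)" for n
      using that xu(1) self_adjoint_op_graph[OF A] by blast
    then show "(\<lambda>n. cinner b (x n)) \<longlonglongrightarrow> cinner a (v + z *\<^sub>C x')"
      by (simp add: tendsto_cinner tendsto_const u)
  qed
  then have "A x' = Some (v + z *\<^sub>C x')"
    by (intro iffD2[OF self_adjoint_op_graph[OF A]]) blast
  moreover have "v = (v + z *\<^sub>C x') - z *\<^sub>C x'"
    by simp
  ultimately show "v \<in> {u - z *\<^sub>C x | x u. A x = Some u}"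
    by blast
qed

text \<open>If \<open>y\<close> is orthogonal to the range of \<open>A - z\<close>, then \<open>cinner (A x) y = cinner x (cnj z *\<^sub>C y)\<close>
  on the domain, so self-adjointness puts \<open>y\<close> into the domain with \<open>A y = cnj z *\<^sub>C y\<close>.  The lower
  bound for \<open>cnj z\<close> forces \<open>y = 0\<close>, and the range, being closed, is the whole space.\<close>

lemma self_adjoint_op_surjective:
  fixes A :: "'a::chilbert_space partial_op"
  assumes A: "self_adjoint_op A" and z: "Im z \<noteq> 0"
  shows "\<exists>x. A x = Some (v + z *\<^sub>C x)"
proof -
  let ?S = "{u - z *\<^sub>C x | x u. A x = Some u}"
  have lin: "linear_op A"
    using A by (simp add: self_adjoint_op_def)
  have "v \<in> ?S"
  proof (rule ccontr)
    assume "v \<notin> ?S"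
    have "\<exists>y. y \<noteq> 0 \<and> (\<forall>s\<in>?S. cinner s y = 0)"
    proof (rule exists_orthogonal_to_closed_subspace
        [OF self_adjoint_op_closed_range[OF A z] _ _ _ \<open>v \<notin> ?S\<close>])
      show "0 \<in> ?S"
        using lin by (auto simp: linear_op_def intro!: exI[of _ 0])
    next
      fix a b assume "a \<in> ?S" "b \<in> ?S"
      then obtain x u x' u' where *: "A x = Some u" "A x' = Some u'"
          "a = u - z *\<^sub>C x" "b = u' - z *\<^sub>C x'"
        by blast
      then have "A (x + x') = Some (u + u')" "a + b = (u + u') - z *\<^sub>C (x + x')"
        using lin by (simp_all add: linear_op_def scaleC_add_right)
      then show "a + b \<in> ?S"
        by blast
    next
      fix c a assume "a \<in> ?S"
      then obtain x u where *: "A x = Some u" "a = u - z *\<^sub>C x"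
        by blast
      then have "A (c *\<^sub>C x) = Some (c *\<^sub>C u)" "c *\<^sub>C a = c *\<^sub>C u - z *\<^sub>C (c *\<^sub>C x)"
        using lin
        by (simp_all add: linear_op_def scaleC_diff_right scaleC_scaleC mult.commute)
      then show "c *\<^sub>C a \<in> ?S"
        by blast
    qed
    then obtain y where y: "y \<noteq> 0" "\<And>s. s \<in> ?S \<Longrightarrow> cinner s y = 0"
      by blast
    have "cinner u y = cinner x (cnj z *\<^sub>C y)" if "A x = Some u" for x u
    proof -
      have "cinner (u - z *\<^sub>C x) y = 0"
        using y(2) that by blast
      then show ?thesis
        by (simp add: cinner_simps)
    qed
    then have "A y = Some (cnj z *\<^sub>C y)"
      by (intro iffD2[OF self_adjoint_op_graph[OF A]]) blast
    from self_adjoint_op_lower_bound[OF A this, of "cnj z"] show False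
      using y(1) z by (simp add: mult_le_0_iff)
  qed
  then obtain x u where "A x = Some u" "v = u - z *\<^sub>C x"
    by blast
  then show ?thesis
    by (intro exI[of _ x]) simp
qed

lemma self_adjoint_op_resolvent_exists:
  fixes A :: "'a::chilbert_space partial_op"
  assumes A: "self_adjoint_op A" and z: "Im z \<noteq> 0"
  shows "\<exists>R. is_resolvent A z R"
proof -
  have lin: "linear_op A"
    using A by (simp add: self_adjoint_op_def)
  have "\<forall>v. \<exists>x. A x = Some (v + z *\<^sub>C x)"
    using self_adjoint_op_surjective[OF A z] by blast
  then obtain R where R: "\<And>v. A (R v) = Some (v + z *\<^sub>C R v)"
    by metis
  have inj: "x = x'" if "A x = Some (v + z *\<^sub>C x)" "A x' = Some (v + z *\<^sub>C x')" for x x' v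
  proof -
    have "A (x + (-1) *\<^sub>C x') = Some ((v + z *\<^sub>C x) + (-1) *\<^sub>C (v + z *\<^sub>C x'))"
      using lin that by (simp add: linear_op_def)
    then have "A (x - x') = Some (z *\<^sub>C (x - x'))"
      by (simp add: minus_eq_scaleC[symmetric] scaleC_diff_right)
    from self_adjoint_op_lower_bound[OF A this, of z] show ?thesis
      using z by (simp add: mult_le_0_iff)
  qed
  have add: "R (v + w) = R v + R w" for v w
  proof (rule inj[OF R])
    show "A (R v + R w) = Some (v + w + z *\<^sub>C (R v + R w))"
      using lin R[of v] R[of w] by (simp add: linear_op_def scaleC_add_right ac_simps)
  qed
  have scale: "R (c *\<^sub>C v) = c *\<^sub>C R v" for c v
  proof (rule inj[OF R])
    have "A (c *\<^sub>C R v) = Some (c *\<^sub>C (v + z *\<^sub>C R v))"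
      using lin R[of v] by (simp add: linear_op_def)
    then show "A (c *\<^sub>C R v) = Some (c *\<^sub>C v + z *\<^sub>C (c *\<^sub>C R v))"
      by (simp add: scaleC_add_right scaleC_scaleC mult.commute)
  qed
  have "bounded_linear R"
  proof (rule bounded_linear_intro[where K = "1 / \<bar>Im z\<bar>"])
    fix v
    have "\<bar>Im z\<bar> * norm (R v) \<le> norm v"
      using self_adjoint_op_lower_bound[OF A R[of v], of z] by simp
    then show "norm (R v) \<le> norm v * (1 / \<bar>Im z\<bar>)"
      using z by (simp add: field_simps)
  qed (simp_all add: add scale scaleR_scaleC)
  then have "blinfun_apply (Blinfun R) = R"
    by (rule bounded_linear_Blinfun_apply)
  moreover have "op_shift A z x = Some y \<longleftrightarrow> R y = x" for x y
  proof -
    have "op_shift A z x = Some y \<longleftrightarrow> A x = Some (y + z *\<^sub>C x)"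
      by (auto simp: op_shift_def)
    then show ?thesis
      using inj R by auto
  qed
  ultimately have "is_resolvent A z (Blinfun R)"
    by (simp add: is_resolvent_def complex_linear_def scale)
  then show ?thesis
    by blast
qed

lemma is_resolvent_resolvent:
  assumes "is_resolvent A z R"
  shows "is_resolvent A z (resolvent A z)"
  unfolding resolvent_def
proof (rule theI)
  fix R'
  assume "is_resolvent A z R'"
  then have "R' y = R y" for y
    using assms unfolding is_resolvent_def by blast
  then show "R' = R"
    by (rule blinfun_eqI)
qed (fact assms)


section \<open>Perturbed operators and their M-functions\<close>

text \<open>For \<open>x = R\<^sub>2 y\<close> one has \<open>(A + B1 - z) x = y - (B2 - B1) x\<close>; apply \<open>R\<^sub>1\<close>.\<close>

lemma second_resolvent_identity:
  assumes "is_resolvent (op_plus_bounded A B1) z R1"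
    and "is_resolvent (op_plus_bounded A B2) z R2"
  shows "R2 y = R1 (y - (B2 - B1) (R2 y))"
proof -
  have "op_shift (op_plus_bounded A B2) z (R2 y) = Some y"
    using assms(2) by (simp add: is_resolvent_def)
  then have "op_shift (op_plus_bounded A B1) z (R2 y) = Some (y - (B2 - B1) (R2 y))"
    by (auto simp: op_shift_def op_plus_bounded_def blinfun.diff_left algebra_simps)
  then show ?thesis
    using assms(1) by (simp add: is_resolvent_def)
qed

lemma H_pert_is_resolvent:
  fixes H0 :: "'h::chilbert_space partial_op"
    and K :: "'k::chilbert_space \<Rightarrow>\<^sub>L 'h"
  assumes "self_adjoint_op H0" and K: "complex_linear K"
    and L: "bounded_self_adjoint L" and "z \<notin> \<real>"
  shows "is_resolvent (H_pert H0 K L) z (resolvent (H_pert H0 K L) z)"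
proof -
  have L': "complex_linear L" "cadjoint L = L"
    using L by (simp_all add: bounded_self_adjoint_def)
  have "self_adjoint_op (H_pert H0 K L)"
    unfolding H_pert_def
  proof (rule self_adjoint_op_plus_bounded[OF assms(1)])
    show "complex_linear (K o\<^sub>L L o\<^sub>L cadjoint K)"
      using K L'(1) complex_linear_cadjoint[OF K] by (simp add: complex_linear_def)
  next
    fix x y
    have "cinner x (K w) = cinner (cadjoint K x) w" for w
      using cinner_cadjoint[OF K, of w x] cinner_commute[of x "K w"]
        cinner_commute[of "cadjoint K x" w] by simp
    then show "cinner ((K o\<^sub>L L o\<^sub>L cadjoint K) x) y = cinner x ((K o\<^sub>L L o\<^sub>L cadjoint K) y)"
      by (simp add: cinner_cadjoint[OF K] cinner_cadjoint[OF L'(1)] L'(2))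
  qed
  moreover have "Im z \<noteq> 0"
    using \<open>z \<notin> \<real>\<close> by (simp add: complex_is_Real_iff)
  ultimately show ?thesis
    using self_adjoint_op_resolvent_exists is_resolvent_resolvent by blast
qed

lemma M_fun_identity:
  fixes K :: "'k::chilbert_space \<Rightarrow>\<^sub>L 'h::chilbert_space"
  assumes "is_resolvent (H_pert H0 K L1) z (resolvent (H_pert H0 K L1) z)"
    and "is_resolvent (H_pert H0 K L2) z (resolvent (H_pert H0 K L2) z)"
  shows "M_fun H0 K L2 z = M_fun H0 K L1 z - (M_fun H0 K L1 z o\<^sub>L (L2 - L1) o\<^sub>L M_fun H0 K L2 z)"
proof (rule blinfun_eqI)
  fix x
  let ?R1 = "resolvent (H_pert H0 K L1) z" and ?R2 = "resolvent (H_pert H0 K L2) z"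
  have *: "((K o\<^sub>L L2 o\<^sub>L cadjoint K) - (K o\<^sub>L L1 o\<^sub>L cadjoint K)) v = K ((L2 - L1) (cadjoint K v))"
    for v
    by (simp add: blinfun.diff_left blinfun.diff_right)
  have "?R2 (K x) = ?R1 (K x - K ((L2 - L1) (cadjoint K (?R2 (K x)))))"
    using second_resolvent_identity[OF assms[unfolded H_pert_def], of "K x"]
    unfolding * by (simp add: H_pert_def)
  then have "cadjoint K (?R2 (K x))
      = cadjoint K (?R1 (K x - K ((L2 - L1) (cadjoint K (?R2 (K x))))))"
    by simp
  then show "M_fun H0 K L2 z x
      = (M_fun H0 K L1 z - (M_fun H0 K L1 z o\<^sub>L (L2 - L1) o\<^sub>L M_fun H0 K L2 z)) x"
    by (simp add: M_fun_def blinfun.diff_left[of "_ o\<^sub>L _ o\<^sub>L _"] blinfun.diff_right)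
qed

lemma complex_linear_M_fun:
  assumes "complex_linear K"
    and "is_resolvent (H_pert H0 K L) z (resolvent (H_pert H0 K L) z)"
  shows "complex_linear (M_fun H0 K L z)"
  using assms complex_linear_cadjoint[OF assms(1)]
  by (simp add: M_fun_def is_resolvent_def complex_linear_def)

lemma bounded_inverse_eq:
  assumes "is_bounded_inverse T S"
  shows "bounded_inverse T = S"
  unfolding bounded_inverse_def
proof (rule the_equality)
  fix S'
  assume "is_bounded_inverse T S'"
  then have "S' (T v) = v" "T (S v) = v" for v
    using assms by (metis is_bounded_inverse_def blinfun_apply_blinfun_compose
        blinfun_apply_id_blinfun)+
  then show "S' = S"
    by (metis blinfun_eqI)
qed (fact assms)

text \<open>Expanding each product leaves \<open>I\<close> plus a multiple of one of the two hypotheses, so that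
  the explicit candidates are indeed inverses.\<close>

lemma inverses_from_M_identities:
  fixes M1 M2 D :: "'k::complex_inner \<Rightarrow>\<^sub>L 'k"
  assumes M2: "M2 = M1 - (M1 o\<^sub>L D o\<^sub>L M2)" and M1: "M1 = M2 + (M2 o\<^sub>L D o\<^sub>L M1)"
    and lin: "complex_linear M2" "complex_linear D"
  shows "is_bounded_inverse (id_blinfun + (D o\<^sub>L M1)) (id_blinfun - (D o\<^sub>L M2))"
    and "is_bounded_inverse (id_blinfun + (M1 o\<^sub>L D)) (id_blinfun - (M2 o\<^sub>L D))"
    and "M2 = M1 o\<^sub>L (id_blinfun - (D o\<^sub>L M2))"
    and "M2 = (id_blinfun - (M2 o\<^sub>L D)) o\<^sub>L M1"
proof -
  have M2x: "M1 (D (M2 x)) = M1 x - M2 x" for x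
    using arg_cong[OF M2, of "\<lambda>T. T x"] by (simp add: blinfun.diff_left algebra_simps)
  have M1x: "M2 (D (M1 x)) = M1 x - M2 x" for x
    using arg_cong[OF M1, of "\<lambda>T. T x"] by (simp add: blinfun.add_left algebra_simps)
  note simps = blinfun.add_left blinfun.diff_left blinfun.add_right blinfun.diff_right M1x M2x
  have "complex_linear (id_blinfun - (D o\<^sub>L M2))" "complex_linear (id_blinfun - (M2 o\<^sub>L D))"
    using lin by (simp_all add: complex_linear_def blinfun.diff_left scaleC_diff_right)
  then show "is_bounded_inverse (id_blinfun + (D o\<^sub>L M1)) (id_blinfun - (D o\<^sub>L M2))"
    and "is_bounded_inverse (id_blinfun + (M1 o\<^sub>L D)) (id_blinfun - (M2 o\<^sub>L D))"
    by (auto simp: is_bounded_inverse_def simps intro!: blinfun_eqI)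
  show "M2 = M1 o\<^sub>L (id_blinfun - (D o\<^sub>L M2))" "M2 = (id_blinfun - (M2 o\<^sub>L D)) o\<^sub>L M1"
    by (rule blinfun_eqI, simp add: simps)+
qed

theorem theorem3p4:
  fixes H0 :: "'h::chilbert_space partial_op"
    and K :: "'k::chilbert_space \<Rightarrow>\<^sub>L 'h"
    and L1 L2 :: "'k \<Rightarrow>\<^sub>L 'k"
  assumes "separable_space (euclidean :: 'h topology)"
    and "separable_space (euclidean :: 'k topology)"
    and "self_adjoint_op H0"
    and "complex_linear K"
    and "bounded_self_adjoint L1"
    and "bounded_self_adjoint L2"
  shows "\<forall>z::complex. z \<notin> \<real> \<longrightarrow>
    z \<in> resolvent_set (H_pert H0 K L1) \<and>
    z \<in> resolvent_set (H_pert H0 K L2) \<and>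
    boundedly_invertible (id_blinfun + ((L2 - L1) o\<^sub>L M_fun H0 K L1 z)) \<and>
    boundedly_invertible (id_blinfun + (M_fun H0 K L1 z o\<^sub>L (L2 - L1))) \<and>
    M_fun H0 K L2 z =
      M_fun H0 K L1 z o\<^sub>L bounded_inverse (id_blinfun + ((L2 - L1) o\<^sub>L M_fun H0 K L1 z)) \<and>
    M_fun H0 K L2 z =
      bounded_inverse (id_blinfun + (M_fun H0 K L1 z o\<^sub>L (L2 - L1))) o\<^sub>L M_fun H0 K L1 z"
proof (intro allI impI)
  fix z :: complex
  assume "z \<notin> \<real>"
  let ?M1 = "M_fun H0 K L1 z" and ?M2 = "M_fun H0 K L2 z" and ?D = "L2 - L1"
  note res1 = H_pert_is_resolvent[OF assms(3,4,5) \<open>z \<notin> \<real>\<close>]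
  note res2 = H_pert_is_resolvent[OF assms(3,4,6) \<open>z \<notin> \<real>\<close>]
  have M2: "?M2 = ?M1 - (?M1 o\<^sub>L ?D o\<^sub>L ?M2)"
    by (rule M_fun_identity[OF res1 res2])
  have "?M1 = ?M2 - (?M2 o\<^sub>L (L1 - L2) o\<^sub>L ?M1)"
    by (rule M_fun_identity[OF res2 res1])
  also have "\<dots> = ?M2 + (?M2 o\<^sub>L ?D o\<^sub>L ?M1)"
    by (rule blinfun_eqI) (simp add: blinfun.diff_left blinfun.add_left blinfun.diff_right)
  finally have M1: "?M1 = ?M2 + (?M2 o\<^sub>L ?D o\<^sub>L ?M1)" .
  have "complex_linear ?D"
    using assms(5,6)
    by (simp add: bounded_self_adjoint_def complex_linear_def blinfun.diff_left scaleC_diff_right)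
  note inv = inverses_from_M_identities[OF M2 M1 complex_linear_M_fun[OF assms(4) res2] this]
  show "z \<in> resolvent_set (H_pert H0 K L1) \<and>
    z \<in> resolvent_set (H_pert H0 K L2) \<and>
    boundedly_invertible (id_blinfun + (?D o\<^sub>L ?M1)) \<and>
    boundedly_invertible (id_blinfun + (?M1 o\<^sub>L ?D)) \<and>
    ?M2 = ?M1 o\<^sub>L bounded_inverse (id_blinfun + (?D o\<^sub>L ?M1)) \<and>
    ?M2 = bounded_inverse (id_blinfun + (?M1 o\<^sub>L ?D)) o\<^sub>L ?M1"
    unfolding bounded_inverse_eq[OF inv(1)] bounded_inverse_eq[OF inv(2)]
    using res1 res2 inv by (auto simp: resolvent_set_def boundedly_invertible_def)
qed

end
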